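(* Let $M'_n$ be the maximal distance of any vertex to its nearest leaf in the uniform random recursive tree $T'_n$ with $n$ vertices. Then $$M'_n=\Theta\left(\frac{\log n}{\log\log n}\right)\quad\text{in probability.}$$
   Context: The uniform random recursive tree (URRT) process $(T'_n)_{n\ge 2}$: $T'_2$ is a single edge joining vertices $1$ and $2$, and for $n\ge 2$, $T'_{n+1}$ is obtained from $T'_n$ by adding a vertex labelled $n+1$ joined by an edge to a uniformly random vertex of $\{1,\dots,n\}$, chosen independently of the past. A leaf is a vertex of degree one. Explicitly, $M'_n=\max_{i\le n}\min_{\ell}d'_n(i,\ell)$, where $d'_n$ is graph distance in $T'_n$ and the minimum is over vertices $\ell$ of degree one in $T'_n$. For sequences $(X_n),(Y_n)$ of non-negative random variables: $X_n=O_p(Y_n)$, equivalently $Y_n=\Omega_p(X_n)$, means that for all $\varepsilon>0$ there exist $N>0$ and $K>0$ such that $\mathbf{P}\{X_n>KY_n\}<\varepsilon$ for all $n\ge N$. "$X_n=\Theta(Y_n)$ in probability" means that both $X_n=O_p(Y_n)$ and $X_n=\Omega_p(Y_n)$ hold. (Only large $n$, for which $\log\log n>0$, matter.) *)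

theory Defs
  imports "HOL-Probability.Probability"
begin

text \<open>
  A graph is given by its set of undirected edges, each edge being a two-element set of vertices;
  the vertex set is supplied separately where it matters.
\<close>

definition adj :: "'a set set \<Rightarrow> ('a \<times> 'a) set" where
  "adj E = {(u, v). {u, v} \<in> E}"

text \<open>
  Graph distance is the length of a shortest walk. It is an unspecified number for vertices in
  different components, which does not occur in a tree.
\<close>

definition graph_dist :: "'a set set \<Rightarrow> 'a \<Rightarrow> 'a \<Rightarrow> nat" where
  "graph_dist E u v = (LEAST k. (u, v) \<in> adj E ^^ k)"

definition degree :: "'a set set \<Rightarrow> 'a \<Rightarrow> nat" where
  "degree E v = card {e \<in> E. v \<in> e}"

definition leaves :: "'a set \<Rightarrow> 'a set set \<Rightarrow> 'a set" where
  "leaves V E = {v \<in> V. degree E v = 1}"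

definition max_leaf_dist :: "'a set \<Rightarrow> 'a set set \<Rightarrow> nat" where
  "max_leaf_dist V E = Max ((\<lambda>i. Min ((\<lambda>l. graph_dist E i l) ` leaves V E)) ` V)"

text \<open>
  The process on an arbitrary probability space. \<open>T n \<omega>\<close> is the edge set of a tree with vertex set
  \<open>{1..n}\<close>, for \<open>n \<ge> 2\<close>, and \<open>parent n\<close> is the vertex of \<open>{1..n}\<close> to which vertex \<open>n + 1\<close> is
  attached. As \<open>T 2, \<dots>, T n\<close> and \<open>parent 2, \<dots>, parent (n - 1)\<close> determine each other, each
  choice being independent of the past amounts to mutual independence of the choices.
\<close>

locale urrt_process = prob_space M for M :: "'w measure" +
  fixes T :: "nat \<Rightarrow> 'w \<Rightarrow> nat set set"
    and parent :: "nat \<Rightarrow> 'w \<Rightarrow> nat"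
  assumes parent_indep: "indep_vars (\<lambda>n. count_space {1..n}) parent {2..}"
    and parent_uniform:
      "n \<ge> 2 \<Longrightarrow> distr M (count_space {1..n}) (parent n) = uniform_count_measure {1..n}"
    and T_2: "\<omega> \<in> space M \<Longrightarrow> T 2 \<omega> = {{1, 2}}"
    and T_Suc: "n \<ge> 2 \<Longrightarrow> \<omega> \<in> space M \<Longrightarrow> T (Suc n) \<omega> = insert {parent n \<omega>, Suc n} (T n \<omega>)"

definition bigO_p :: "'w measure \<Rightarrow> (nat \<Rightarrow> 'w \<Rightarrow> real) \<Rightarrow> (nat \<Rightarrow> 'w \<Rightarrow> real) \<Rightarrow> bool" where
  "bigO_p M X Y \<longleftrightarrow> (\<forall>\<epsilon>>0. \<exists>N>0. \<exists>K>0. \<forall>n\<ge>N.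
     measure M {\<omega> \<in> space M. X n \<omega> > K * Y n \<omega>} < \<epsilon>)"

definition bigOmega_p :: "'w measure \<Rightarrow> (nat \<Rightarrow> 'w \<Rightarrow> real) \<Rightarrow> (nat \<Rightarrow> 'w \<Rightarrow> real) \<Rightarrow> bool" where
  "bigOmega_p M X Y \<longleftrightarrow> bigO_p M Y X"

definition bigTheta_p :: "'w measure \<Rightarrow> (nat \<Rightarrow> 'w \<Rightarrow> real) \<Rightarrow> (nat \<Rightarrow> 'w \<Rightarrow> real) \<Rightarrow> bool" where
  "bigTheta_p M X Y \<longleftrightarrow> bigO_p M X Y \<and> bigOmega_p M X Y"

end

theory Submission
  imports Defs "HOL-Real_Asymp.Real_Asymp"
begin

text \<open>
  The tree on \<open>n\<close> vertices is determined by the sequence of its attachments, and each of the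
  \<open>(n - 1)!\<close> possible sequences is equally likely (\<open>prob_tree_property\<close>). Every probability is
  therefore a proportion of sequences, and both halves of the theorem are counting arguments.
  Write \<open>L = ln n / ln (ln n)\<close>; what matters about it is that \<open>L\<close> to the power \<open>c * L\<close> is
  \<open>n\<close> to the power \<open>c + o(1)\<close>.

  For the upper bound, walk away from the root: from a vertex \<open>v\<close> move to its youngest child, then
  to the youngest child of that child, and so on until a childless vertex, which is a leaf. The
  youngest child is the right choice because the length \<open>D\<close> of this walk evolves as a Markov chain
  while the tree grows. A new vertex attached to the \<open>i\<close>-th vertex of the walk (counted from 0)
  discards everything after that vertex and changes the length to \<open>i + 1\<close>; any other
  attachment leaves the walk alone. Hence \<open>D\<close> can reach \<open>d\<close> from below in only one way out of
  \<open>n\<close>, from \<open>d - 1\<close>, and drops below \<open>d\<close> in \<open>d - 1\<close> ways out of \<open>n\<close>, so that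
  \<open>P(D\<^sub>n\<^sub>+\<^sub>1 \<ge> d) \<le> (1 - d / n) P(D\<^sub>n \<ge> d) + P(D\<^sub>n \<ge> d - 1) / n\<close>
  for \<open>1 \<le> d \<le> n\<close>.
  The bound \<open>P(D\<^sub>n \<ge> d) \<le> 1 / d!\<close> is preserved by this recursion (\<open>card_long_heir_path\<close>).
  A union bound over \<open>v\<close> gives at most \<open>n / d!\<close> for the probability that some vertex is at distance
  at least \<open>d\<close> from all leaves, and this is at most \<open>1 / n\<close> for
  large \<open>n\<close> when \<open>d \<ge> 3 * L\<close>.

  For the lower bound, look for a fringe path: \<open>k = 2 * m\<close> non-root vertices in increasing order,
  each of them the only child of the one before, the last one childless. Its middle vertex is at
  distance at least \<open>m\<close> from every leaf (\<open>fringe_path_max_leaf_dist\<close>). Up to factors exponential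
  in \<open>k\<close>, a given sequence of late vertices is a fringe path with probability \<open>n\<close> to the power
  \<open>1 - k\<close>, and there are \<open>(n / k)\<^sup>k\<close> such sequences. So the expected number of fringe paths is
  about \<open>n / (c * k)\<^sup>k\<close> with a constant \<open>c\<close>, which tends to infinity when \<open>k\<close> is about \<open>L / 4\<close>.
  The second moment method turns this into existence (\<open>prob_le_max_leaf_dist\<close>): two sequences that
  share a vertex cannot both be fringe paths, and two disjoint ones are nearly independent.
\<close>

section \<open>Recursive trees as attachment sequences\<close>

text \<open>
  Vertex \<open>t + 1\<close> is attached to \<open>f t\<close>, as in the process. Starting at \<open>t = 1\<close> forces \<open>f 1 = 1\<close>
  and makes the initial edge \<open>{1, 2}\<close> an attachment like the others, so that recursions can
  begin with the single vertex 1.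
\<close>

definition attachments :: "nat \<Rightarrow> (nat \<Rightarrow> nat) set" where
  "attachments n = (\<Pi>\<^sub>E t\<in>{1..<n}. {1..t})"

definition rtree :: "nat \<Rightarrow> (nat \<Rightarrow> nat) \<Rightarrow> nat set set" where
  "rtree n f = (\<lambda>t. {f t, Suc t}) ` {1..<n}"

lemma rtree_edge: "1 \<le> t \<Longrightarrow> t < n \<Longrightarrow> {f t, Suc t} \<in> rtree n f"
  by (simp add: rtree_def)

lemma finite_attachments [simp]: "finite (attachments n)"
  by (simp add: attachments_def finite_PiE)

lemma attachmentsD:
  assumes "f \<in> attachments n" "1 \<le> t" "t < n"
  shows "1 \<le> f t" "f t \<le> t"
  using assms by (auto simp: attachments_def dest: PiE_mem)

lemma card_attachments: "card (attachments n) = fact (n - 1)"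
proof -
  have "card (attachments n) = (\<Prod>t\<in>{1..<n}. t)"
    by (simp add: attachments_def card_PiE)
  also have "{1..<n} = {1..n - 1}"
    by auto
  finally show ?thesis
    by (simp add: fact_prod)
qed

section \<open>Uniformity of the attachment sequence\<close>

context urrt_process
begin

definition choices :: "nat \<Rightarrow> 'w \<Rightarrow> nat \<Rightarrow> nat" where
  "choices n \<omega> = (\<lambda>t\<in>{1..<n}. if t = 1 then 1 else parent t \<omega>)"

lemma parent_measurable:
  "t \<ge> 2 \<Longrightarrow> parent t \<in> measurable M (count_space {1..t})"
  using parent_indep by (auto simp: indep_vars_def2)

lemma parent_range: "t \<ge> 2 \<Longrightarrow> \<omega> \<in> space M \<Longrightarrow> parent t \<omega> \<in> {1..t}"
  using measurable_space[OF parent_measurable] by fastforce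

lemma choices_attachments: "\<omega> \<in> space M \<Longrightarrow> choices n \<omega> \<in> attachments n"
  unfolding choices_def attachments_def
  using parent_range by fastforce

lemma T_eq_rtree:
  assumes "n \<ge> 2" "\<omega> \<in> space M"
  shows "T n \<omega> = rtree n (choices n \<omega>)"
  using assms(1)
proof (induction n rule: dec_induct)
  case base
  have "{1..<2::nat} = {1}" by auto
  then show ?case
    using T_2[OF assms(2)] by (simp add: rtree_def choices_def numeral_2_eq_2)
next
  case (step n)
  have "{1..<Suc n} = insert n {1..<n}" using step by auto
  then have "rtree (Suc n) (choices (Suc n) \<omega>)
      = insert {parent n \<omega>, Suc n} (rtree n (choices (Suc n) \<omega>))"
    using step by (simp add: rtree_def choices_def)
  also have "rtree n (choices (Suc n) \<omega>) = rtree n (choices n \<omega>)"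
    by (auto simp: rtree_def choices_def)
  finally show ?case using T_Suc[OF _ assms(2)] step by simp
qed

lemma parent_point_prob:
  assumes "t \<ge> 2" "x \<in> {1..t}"
  shows "prob (parent t -` {x} \<inter> space M) = 1 / real t"
proof -
  have "prob (parent t -` {x} \<inter> space M) = measure (distr M (count_space {1..t}) (parent t)) {x}"
    using assms parent_measurable[OF assms(1)] by (subst measure_distr) auto
  also have "\<dots> = measure (uniform_count_measure {1..t}) {x}"
    using assms parent_uniform by simp
  also have "\<dots> = 1 / real t"
    using assms by (simp add: measure_uniform_count_measure)
  finally show ?thesis .
qed

lemma choices_point:
  assumes "n \<ge> 2" "f \<in> attachments n"
  shows "{\<omega> \<in> space M. choices n \<omega> = f} \<in> events"
    and "prob {\<omega> \<in> space M. choices n \<omega> = f} = 1 / fact (n - 1)"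
proof -
  have f1: "f 1 = 1"
    using attachmentsD[OF assms(2), of 1] assms(1) by simp
  \<comment> \<open>The first choice is forced, so only the random choices from time 2 on impose a condition.\<close>
  have eq: "{\<omega> \<in> space M. choices n \<omega> = f}
      = {\<omega> \<in> space M. \<forall>t\<in>{2..<n}. parent t \<omega> = f t}" (is "?A = ?B")
  proof (intro Collect_cong conj_cong refl)
    fix \<omega> assume w: "\<omega> \<in> space M"
    have "choices n \<omega> = f \<longleftrightarrow> (\<forall>t\<in>{1..<n}. choices n \<omega> t = f t)"
      using choices_attachments[OF w, of n] assms(2) unfolding attachments_def
      by (metis PiE_ext)
    also have "\<dots> \<longleftrightarrow> (\<forall>t\<in>{2..<n}. parent t \<omega> = f t)"
    proof
      assume *: "\<forall>t\<in>{1..<n}. choices n \<omega> t = f t"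
      show "\<forall>t\<in>{2..<n}. parent t \<omega> = f t"
      proof
        fix t assume "t \<in> {2..<n}"
        then show "parent t \<omega> = f t" using bspec[OF *, of t] by (simp add: choices_def)
      qed
    next
      assume *: "\<forall>t\<in>{2..<n}. parent t \<omega> = f t"
      show "\<forall>t\<in>{1..<n}. choices n \<omega> t = f t"
      proof
        fix t assume "t \<in> {1..<n}"
        then show "choices n \<omega> t = f t"
          using bspec[OF *, of t] f1 by (cases "t = 1") (auto simp: choices_def)
      qed
    qed
    finally show "choices n \<omega> = f \<longleftrightarrow> (\<forall>t\<in>{2..<n}. parent t \<omega> = f t)" .
  qed
  have one: "parent t -` {f t} \<inter> space M \<in> events" if "t \<in> {2..<n}" for t
    using that attachmentsD[OF assms(2), of t]
    by (intro measurable_sets[OF parent_measurable]) auto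
  have "prob ?B = (\<Prod>t\<in>{2..<n}. 1 / real t) \<and> ?B \<in> events"
  \<comment> \<open>The product rule for independent variables needs a non-empty index set.\<close>
  proof (cases "n = 2")
    case True
    then show ?thesis by (simp add: prob_space)
  next
    case False
    have B: "?B = (\<Inter>t\<in>{2..<n}. parent t -` {f t} \<inter> space M)"
      using False assms(1) by auto
    have "prob (\<Inter>t\<in>{2..<n}. parent t -` {f t} \<inter> space M)
        = (\<Prod>t\<in>{2..<n}. prob (parent t -` {f t} \<inter> space M))"
      using False assms attachmentsD[OF assms(2)]
      by (intro indep_varsD[OF parent_indep]) auto
    also have "\<dots> = (\<Prod>t\<in>{2..<n}. 1 / real t)"
      using attachmentsD[OF assms(2)] by (intro prod.cong refl parent_point_prob) auto
    finally show ?thesis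
      unfolding B using False assms(1) one by (intro conjI sets.finite_INT) auto
  qed
  moreover have "(\<Prod>t\<in>{2..<n}. 1 / real t) = 1 / fact (n - 1)"
  proof -
    have "{1..n - 1} = insert 1 {2..<n}"
      using assms(1) by auto
    then have "(fact (n - 1) :: real) = (\<Prod>t\<in>{2..<n}. real t)"
      by (simp add: fact_prod)
    then show ?thesis
      by (simp add: prod_dividef)
  qed
  ultimately show "?A \<in> events" "prob ?A = 1 / fact (n - 1)"
    unfolding eq by auto
qed

text \<open>
  The event is a disjoint union of point events for the attachment sequence, which all have
  probability \<open>1 / (n - 1)!\<close> by independence.
\<close>

lemma prob_tree_property:
  assumes "n \<ge> 2"
  shows "{\<omega> \<in> space M. Q (T n \<omega>)} \<in> events"
    and "prob {\<omega> \<in> space M. Q (T n \<omega>)}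
    = card {f \<in> attachments n. Q (rtree n f)} / fact (n - 1)"
proof -
  let ?F = "{f \<in> attachments n. Q (rtree n f)}"
  have eq: "{\<omega> \<in> space M. Q (T n \<omega>)} = (\<Union>f\<in>?F. {\<omega> \<in> space M. choices n \<omega> = f})"
    using choices_attachments T_eq_rtree[OF assms] by auto
  show "{\<omega> \<in> space M. Q (T n \<omega>)} \<in> events"
    unfolding eq using assms by (intro sets.finite_UN choices_point(1)) auto
  from eq have "prob {\<omega> \<in> space M. Q (T n \<omega>)} = prob (\<Union>f\<in>?F. {\<omega> \<in> space M. choices n \<omega> = f})"
    by simp
  also have "\<dots> = (\<Sum>f\<in>?F. prob {\<omega> \<in> space M. choices n \<omega> = f})"
    using assms by (intro finite_measure_finite_Union)
      (auto simp: disjoint_family_on_def choices_point(1))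
  also have "\<dots> = (\<Sum>f\<in>?F. 1 / fact (n - 1))"
    using assms by (intro sum.cong refl choices_point(2)) auto
  finally show "prob {\<omega> \<in> space M. Q (T n \<omega>)} = card ?F / fact (n - 1)" by simp
qed

end

section \<open>Distances to the leaves of a recursive tree\<close>

lemma graph_dist_le: "(u, v) \<in> adj E ^^ k \<Longrightarrow> graph_dist E u v \<le> k"
  unfolding graph_dist_def by (rule Least_le)

text \<open>
  A function that grows by at most 1 along each edge bounds distances from below. Connectedness
  enters because the distance is an unspecified number when there is no walk at all.
\<close>

lemma potential_le_graph_dist:
  fixes g :: "'a \<Rightarrow> nat"
  assumes "\<And>x y. {x, y} \<in> E \<Longrightarrow> g x \<le> Suc (g y)" and "(u, v) \<in> (adj E)\<^sup>*"
  shows "g u \<le> g v + graph_dist E u v"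
proof -
  have step: "(x, y) \<in> adj E ^^ k \<Longrightarrow> g x \<le> g y + k" for x y k
  proof (induction k arbitrary: y)
    case (Suc k)
    then obtain z where "(x, z) \<in> adj E ^^ k" "(z, y) \<in> adj E" by auto
    then show ?case using Suc.IH[of z] assms(1)[of z y] by (simp add: adj_def)
  qed simp
  obtain k where "(u, v) \<in> adj E ^^ k"
    using assms(2) rtrancl_imp_relpow by blast
  then have "(u, v) \<in> adj E ^^ graph_dist E u v"
    unfolding graph_dist_def by (rule LeastI)
  then show ?thesis by (rule step)
qed

lemma max_leaf_dist_le:
  assumes "finite V" "V \<noteq> {}" "\<And>i. i \<in> V \<Longrightarrow> \<exists>l\<in>leaves V E. graph_dist E i l \<le> d"
  shows "max_leaf_dist V E \<le> d"
proof -
  have fin: "finite (leaves V E)" using assms(1) by (simp add: leaves_def)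
  show ?thesis
    unfolding max_leaf_dist_def using assms fin
    by (auto intro!: Max.boundedI) (meson Min_le finite_imageI imageI le_trans)
qed

lemma le_max_leaf_dist:
  assumes "finite V" "i \<in> V" "leaves V E \<noteq> {}" "\<And>l. l \<in> leaves V E \<Longrightarrow> m \<le> graph_dist E i l"
  shows "m \<le> max_leaf_dist V E"
proof -
  have fin: "finite (leaves V E)" using assms(1) by (simp add: leaves_def)
  have "m \<le> Min ((\<lambda>l. graph_dist E i l) ` leaves V E)"
    using fin assms by (auto intro!: Min.boundedI)
  also have "\<dots> \<le> max_leaf_dist V E"
    unfolding max_leaf_dist_def using assms(1,2) by (intro Max_ge) auto
  finally show ?thesis .
qed

lemma rtree_connected:
  assumes f: "f \<in> attachments n" and uv: "u \<in> {1..n}" "v \<in> {1..n}"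
  shows "(u, v) \<in> (adj (rtree n f))\<^sup>*"
proof -
  have to_root: "x \<in> {1..n} \<Longrightarrow> (x, 1) \<in> (adj (rtree n f))\<^sup>*" for x
  proof (induction x rule: less_induct)
    case (less x)
    show ?case
    proof (cases "x = 1")
      case False
      then have t: "1 \<le> x - 1" "x - 1 < n" and x: "Suc (x - 1) = x"
        using less.prems by auto
      have "{f (x - 1), Suc (x - 1)} \<in> rtree n f"
        unfolding rtree_def using t by (intro imageI) auto
      then have "(x, f (x - 1)) \<in> adj (rtree n f)"
        unfolding x by (simp add: adj_def insert_commute)
      moreover have "(f (x - 1), 1) \<in> (adj (rtree n f))\<^sup>*"
        using attachmentsD[OF f t] t by (intro less.IH) auto
      ultimately show ?thesis by (rule converse_rtrancl_into_rtrancl)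
    qed simp
  qed
  have "sym ((adj (rtree n f))\<^sup>*)"
    by (intro sym_rtrancl symI) (simp add: adj_def insert_commute)
  then show ?thesis
    using to_root[OF uv(1)] to_root[OF uv(2)] by (meson rtrancl_trans symD)
qed

text \<open>
  A childless vertex other than the root has only the edge to its parent; the root cannot be
  childless, since vertex 2 is attached to it.
\<close>

lemma childless_leaf:
  assumes "f \<in> attachments n" "2 \<le> n" "x \<in> {1..n}" "\<And>t. 1 \<le> t \<Longrightarrow> t < n \<Longrightarrow> f t \<noteq> x"
  shows "x \<in> leaves {1..n} (rtree n f)"
proof -
  have "f 1 = 1"
    using attachmentsD[OF assms(1), of 1] assms(2) by simp
  then have x: "2 \<le> x"
    using assms(2,3) assms(4)[of 1] by force
  have "{e \<in> rtree n f. x \<in> e} = {{f (x - 1), x}}"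
  proof (intro equalityI subsetI)
    fix e assume "e \<in> {e \<in> rtree n f. x \<in> e}"
    then obtain t where "1 \<le> t" "t < n" "e = {f t, Suc t}" "x \<in> e"
      by (auto simp: rtree_def)
    then show "e \<in> {{f (x - 1), x}}" using assms(4)[of t] by auto
  next
    fix e assume "e \<in> {{f (x - 1), x}}"
    then have "e = {f (x - 1), Suc (x - 1)}" "x \<in> e" using x by simp_all
    moreover have "x - 1 \<in> {1..<n}" using x assms(3) by auto
    ultimately show "e \<in> {e \<in> rtree n f. x \<in> e}"
      unfolding rtree_def by blast
  qed
  then show ?thesis using assms(3) by (simp add: leaves_def degree_def)
qed

section \<open>Upper bound: walking to the youngest child\<close>

text \<open>
  The walk after a new vertex \<open>y\<close> has been attached to \<open>x\<close>: if \<open>x\<close> lies on the walk, then \<open>y\<close> is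
  now its youngest child and the old continuation behind \<open>x\<close> is given up.
\<close>

definition graft :: "'a list \<Rightarrow> 'a \<Rightarrow> 'a \<Rightarrow> 'a list" where
  "graft p x y = (if x \<in> set p then takeWhile (\<lambda>z. z \<noteq> x) p @ [x, y] else p)"

text \<open>
  The walk from \<open>v\<close> to youngest children in the tree on \<open>n\<close> vertices, including \<open>v\<close> itself. While
  \<open>n < v\<close> it is the trivial walk, as nothing can be attached to \<open>v\<close> yet. The tree with one vertex
  needs its own clause, since the first attachment is \<open>f 1\<close>; the clause for 0 is a default.
\<close>

fun heir_path :: "(nat \<Rightarrow> nat) \<Rightarrow> nat \<Rightarrow> nat \<Rightarrow> nat list" where
  "heir_path f v 0 = [v]"
| "heir_path f v (Suc 0) = [v]"
| "heir_path f v (Suc (Suc n)) = graft (heir_path f v (Suc n)) (f (Suc n)) (Suc (Suc n))"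

lemma heir_path_Suc:
  "1 \<le> n \<Longrightarrow> heir_path f v (Suc n) = graft (heir_path f v n) (f n) (Suc n)"
  by (cases n) auto

lemma heir_path_cong:
  "(\<And>t. 1 \<le> t \<Longrightarrow> t < n \<Longrightarrow> f t = g t) \<Longrightarrow> heir_path f v n = heir_path g v n"
  by (induction f v n rule: heir_path.induct) auto

lemma takeWhile_neq_nth:
  assumes "distinct p" "i < length p"
  shows "takeWhile (\<lambda>z. z \<noteq> p ! i) p = take i p"
  using assms by (intro takeWhile_eq_take_P_nth) (auto simp: nth_eq_iff_index_eq)

lemma length_graft:
  assumes "distinct p" "i < length p"
  shows "length (graft p (p ! i) y) = i + 2"
  using assms by (simp add: graft_def takeWhile_neq_nth)

lemma successively_graft:
  assumes "successively R p" "R x y"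
  shows "successively R (graft p x y)"
proof (cases "x \<in> set p")
  case True
  then obtain p1 p2 where p: "p = p1 @ x # p2" "x \<notin> set p1"
    by (auto dest: split_list_first)
  then have "graft p x y = p1 @ [x, y]"
    by (auto simp: graft_def takeWhile_append)
  then show ?thesis
    using assms by (auto simp: p(1) successively_append_iff)
qed (use assms in \<open>simp add: graft_def\<close>)

text \<open>
  The conclusions say together that the walk is a genuine path in the tree from \<open>v\<close> to a childless
  vertex. They have to be proved by one common induction on \<open>n\<close>: that the new vertex can be appended
  without repetition depends on the range of the walk, and that the last vertex stays childless
  depends on whether the new attachment hits the walk. The exception \<open>[v]\<close> covers the time before
  \<open>v\<close> is born.
\<close>

lemma heir_path_invariant:
  assumes f: "\<And>t. 1 \<le> t \<Longrightarrow> t < n \<Longrightarrow> 1 \<le> f t \<and> f t \<le> t" and n: "1 \<le> n"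
  shows "heir_path f v n \<noteq> []" "hd (heir_path f v n) = v" "distinct (heir_path f v n)"
    "heir_path f v n = [v] \<or> set (heir_path f v n) \<subseteq> {1..n}"
    "successively (\<lambda>x y. {x, y} \<in> rtree n f) (heir_path f v n)"
    "v \<le> n \<Longrightarrow> 1 \<le> t \<Longrightarrow> t < n \<Longrightarrow> f t \<noteq> last (heir_path f v n)"
proof -
  let ?I = "\<lambda>n p. p \<noteq> [] \<and> hd p = v \<and> distinct p \<and> (p = [v] \<or> set p \<subseteq> {1..n}) \<and>
    successively (\<lambda>x y. {x, y} \<in> rtree n f) p \<and> (\<forall>t. 1 \<le> t \<longrightarrow> t < n \<longrightarrow> f t \<noteq> last p \<or> n < v)"
  have "?I n (heir_path f v n)"
    using n f
  proof (induction n rule: dec_induct)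
    case base
    then show ?case by simp
  next
    case (step n)
    define p where "p = heir_path f v n"
    have IH: "?I n p" unfolding p_def using step by auto
    have fn: "1 \<le> f n" "f n \<le> n" using step.prems[of n] step.hyps by auto
    have q: "heir_path f v (Suc n) = graft p (f n) (Suc n)"
      using step.hyps by (simp add: heir_path_Suc p_def)
    have mono: "rtree n f \<subseteq> rtree (Suc n) f" and new: "{f n, Suc n} \<in> rtree (Suc n) f"
      using step.hyps by (auto simp: rtree_def)
    have succ: "successively (\<lambda>x y. {x, y} \<in> rtree (Suc n) f) p"
      using IH mono by (auto intro: successively_mono)
    show ?case
    proof (cases "f n \<in> set p")
      case True
      then obtain p1 p2 where p: "p = p1 @ f n # p2" "f n \<notin> set p1"
        by (auto dest: split_list_first)
      then have g: "graft p (f n) (Suc n) = p1 @ [f n, Suc n]"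
        by (auto simp: graft_def takeWhile_append)
      have sub: "set p \<subseteq> {1..n}"
      proof (cases "p = [v]")
        case True
        then show ?thesis using \<open>f n \<in> set p\<close> fn by simp
      qed (use IH in blast)
      have "hd (p1 @ [f n, Suc n]) = hd p" by (cases p1) (auto simp: p(1))
      moreover have "distinct (p1 @ [f n, Suc n])"
        using IH sub fn by (auto simp: p(1))
      moreover have "set (p1 @ [f n, Suc n]) \<subseteq> {1..Suc n}"
        using sub fn by (auto simp: p(1))
      moreover have "f t \<noteq> Suc n" if "1 \<le> t" "t < Suc n" for t
        using step.prems[OF that] that by auto
      ultimately show ?thesis
        using IH successively_graft[OF succ new] unfolding q g by auto
    next
      case False
      then have "graft p (f n) (Suc n) = p" by (simp add: graft_def)
      moreover have "f t \<noteq> last p \<or> Suc n < v" if "1 \<le> t" "t < Suc n" for t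
      proof (cases "t = n")
        case True
        then show ?thesis using False IH last_in_set[of p] by metis
      next
        case ne: False
        then have "f t \<noteq> last p \<or> n < v" using IH that by auto
        \<comment> \<open>The vertex \<open>v\<close> is born in this step, and its walk is still trivial.\<close>
        moreover have "f t \<noteq> last p" if "v = Suc n"
        proof -
          have "p = [v]" using IH that hd_in_set[of p] by fastforce
          then show ?thesis using step.prems[of t] \<open>1 \<le> t\<close> \<open>t < Suc n\<close> that by auto
        qed
        ultimately show ?thesis by (metis Suc_lessI)
      qed
      ultimately show ?thesis unfolding q using IH succ by auto
    qed
  qed
  then show "heir_path f v n \<noteq> []" "hd (heir_path f v n) = v" "distinct (heir_path f v n)"
    "heir_path f v n = [v] \<or> set (heir_path f v n) \<subseteq> {1..n}"
    "successively (\<lambda>x y. {x, y} \<in> rtree n f) (heir_path f v n)"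
    "v \<le> n \<Longrightarrow> 1 \<le> t \<Longrightarrow> t < n \<Longrightarrow> f t \<noteq> last (heir_path f v n)"
    by auto
qed

lemma length_heir_path_le:
  assumes "f \<in> attachments n" "1 \<le> n"
  shows "length (heir_path f v n) \<le> n"
proof -
  let ?p = "heir_path f v n"
  have f: "\<And>t. 1 \<le> t \<Longrightarrow> t < n \<Longrightarrow> 1 \<le> f t \<and> f t \<le> t"
    using attachmentsD[OF assms(1)] by auto
  note I = heir_path_invariant[where f = f and v = v and n = n, OF f assms(2)]
  show ?thesis
  proof (cases "?p = [v]")
    case False
    then have "card (set ?p) \<le> card {1..n}" using I(4) by (intro card_mono) auto
    then show ?thesis using I(3) by (simp add: distinct_card)
  qed (use assms in simp)
qed

lemma successively_relpow:
  "successively R p \<Longrightarrow> p \<noteq> [] \<Longrightarrow> (hd p, last p) \<in> {(x, y). R x y} ^^ (length p - 1)"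
proof (induction p rule: induct_list012)
  case (3 x y p)
  then have "(x, y) \<in> {(x, y). R x y}" "(y, last (y # p)) \<in> {(x, y). R x y} ^^ length p"
    by auto
  then have "(x, last (y # p)) \<in> {(x, y). R x y} ^^ Suc (length p)"
    by (rule relpow_Suc_I2)
  then show ?case by simp
qed auto

text \<open>
  The walk from any vertex ends at a childless vertex, which is a leaf, so the number of its edges
  bounds the distance to the nearest leaf.
\<close>

lemma max_leaf_dist_le_heir_path:
  assumes f: "f \<in> attachments n" and n: "2 \<le> n"
    and short: "\<And>v. v \<in> {1..n} \<Longrightarrow> length (heir_path f v n) \<le> Suc d"
  shows "max_leaf_dist {1..n} (rtree n f) \<le> d"
proof (rule max_leaf_dist_le)
  fix v assume v: "v \<in> {1..n}"
  let ?p = "heir_path f v n"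
  have n1: "1 \<le> n" using n by simp
  have ft: "\<And>t. 1 \<le> t \<Longrightarrow> t < n \<Longrightarrow> 1 \<le> f t \<and> f t \<le> t"
    using attachmentsD[OF f] by auto
  note I = heir_path_invariant[where f = f and v = v and n = n, OF ft n1]
  have "last ?p \<in> {1..n}"
  proof (cases "?p = [v]")
    case False
    then show ?thesis using I(1,4) last_in_set[of ?p] by blast
  qed (use v in simp)
  then have leaf: "last ?p \<in> leaves {1..n} (rtree n f)"
    using I(6) v n by (intro childless_leaf[OF f]) auto
  have "(v, last ?p) \<in> adj (rtree n f) ^^ (length ?p - 1)"
    using successively_relpow[OF I(5,1)] I(2) by (simp add: adj_def)
  then have "graph_dist (rtree n f) v (last ?p) \<le> d"
    using graph_dist_le short[OF v] by fastforce
  then show "\<exists>l\<in>leaves {1..n} (rtree n f). graph_dist (rtree n f) v l \<le> d"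
    using leaf by blast
qed (use n in auto)

text \<open>
  Conditioning on the past: a sequence of attachments up to time \<open>n\<close> is one up to time \<open>n - 1\<close>
  together with a free choice for \<open>n\<close>.
\<close>

lemma card_attachments_Suc:
  assumes "1 \<le> n"
  shows "card {f \<in> attachments (Suc n). P f}
    = (\<Sum>g\<in>attachments n. card {x \<in> {1..n}. P (g(n := x))})"
proof -
  have ins: "{1..<Suc n} = insert n {1..<n}" using assms by auto
  have "bij_betw (\<lambda>(g, x). g(n := x)) (SIGMA g:attachments n. {x \<in> {1..n}. P (g(n := x))})
    {f \<in> attachments (Suc n). P f}"
    unfolding bij_betw_def
  proof
    show "inj_on (\<lambda>(g, x). g(n := x)) (SIGMA g:attachments n. {x \<in> {1..n}. P (g(n := x))})"
    proof (intro inj_onI, clarify)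
      fix g x h y
      assume gh: "g \<in> attachments n" "h \<in> attachments n" and eq: "g(n := x) = h(n := y)"
      have "x = y" using fun_cong[OF eq, of n] by simp
      moreover have "g t = h t" if "t \<in> {1..<n}" for t
        using fun_cong[OF eq, of t] that by simp
      then have "g = h" using gh unfolding attachments_def by (intro PiE_ext)
      ultimately show "g = h \<and> x = y" by simp
    qed
    show "(\<lambda>(g, x). g(n := x)) ` (SIGMA g:attachments n. {x \<in> {1..n}. P (g(n := x))})
        = {f \<in> attachments (Suc n). P f}"
      unfolding attachments_def ins PiE_insert_eq by auto
  qed
  then have "card {f \<in> attachments (Suc n). P f}
      = card (SIGMA g:attachments n. {x \<in> {1..n}. P (g(n := x))})"
    by (simp add: bij_betw_same_card)
  then show ?thesis by simp
qed

text \<open>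
  One step of the Markov chain. A walk that already has at least \<open>d + 1\<close> edges keeps that many
  unless the new vertex is attached to one of its first \<open>d\<close> vertices, which leaves \<open>n - d\<close>
  choices; a walk of exactly \<open>d\<close> edges gets there only by an attachment to its last vertex;
  shorter walks cannot. The choices are counted so that \<open>n - d\<close> is split into
  \<open>n - (d + 1)\<close> and a 1 that merges with the second case.
\<close>

lemma card_graft_longer:
  assumes "distinct p" "p = [v] \<or> set p \<subseteq> {1..n}" "length p \<le> n"
  shows "card {x \<in> {1..n}. Suc d < length (graft p x y)}
    \<le> (if Suc d < length p then n - Suc d else 0) + (if d < length p then 1 else 0)"
proof -
  let ?A = "{x \<in> {1..n}. Suc d < length (graft p x y)}"
  consider "Suc d < length p" | "length p = Suc d" | "length p \<le> d"
    by linarith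
  then show ?thesis
  proof cases
    case 1
    have "p \<noteq> [v]" using 1 by auto
    have sub: "?A \<subseteq> {1..n} - set (take d p)"
    proof
      fix x assume x: "x \<in> ?A"
      have "x \<notin> set (take d p)"
      proof
        assume "x \<in> set (take d p)"
        then obtain i where "i < d" "i < length p" "x = p ! i"
          by (auto simp: in_set_conv_nth)
        then show False using x length_graft[OF assms(1)] by auto
      qed
      then show "x \<in> {1..n} - set (take d p)" using x by simp
    qed
    have "set (take d p) \<subseteq> {1..n}"
      using assms(2) \<open>p \<noteq> [v]\<close> set_take_subset[of d p] by auto
    moreover have "card (set (take d p)) = d"
      using 1 assms(1) by (simp add: distinct_card)
    ultimately have "card ({1..n} - set (take d p)) = n - d"
      by (subst card_Diff_subset) auto
    then have "card ?A \<le> n - d"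
      using card_mono[OF _ sub] by simp
    then show ?thesis using 1 assms(3) by simp
  next
    case 2
    have "?A \<subseteq> {p ! d}"
    proof
      fix x assume x: "x \<in> ?A"
      then have "x \<in> set p" using 2 by (auto simp: graft_def split: if_splits)
      then obtain i where "i < length p" "x = p ! i"
        by (auto simp: in_set_conv_nth)
      then show "x \<in> {p ! d}" using x 2 length_graft[OF assms(1), of i y] by (cases "i = d") auto
    qed
    then have "card ?A \<le> 1" using card_mono[of "{p ! d}" ?A] by simp
    then show ?thesis using 2 by simp
  next
    case 3
    have "?A = {}"
    proof (intro equals0I)
      fix x assume x: "x \<in> ?A"
      then have "x \<in> set p" using 3 by (auto simp: graft_def split: if_splits)
      then obtain i where "i < length p" "x = p ! i"
        by (auto simp: in_set_conv_nth)
      then show False using x 3 length_graft[OF assms(1), of i y] by auto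
    qed
    then show ?thesis by (simp del: Collect_empty_eq)
  qed
qed

text \<open>
  This is the bound \<open>1 / d!\<close> for the probability that the walk from \<open>v\<close> has at least \<open>d\<close> edges. It
  is a fixed point of the recursion given by \<open>card_graft_longer\<close>, since
  \<open>(n - d) / d! + 1 / (d - 1)! = n / d!\<close>.
\<close>

lemma card_long_heir_path:
  assumes "1 \<le> n"
  shows "fact d * card {f \<in> attachments n. d < length (heir_path f v n)} \<le> fact (n - 1)"
  using assms
proof (induction n arbitrary: d rule: dec_induct)
  case base
  show ?case
  proof (cases d)
    case 0
    have "card {f \<in> attachments 1. 0 < length (heir_path f v 1)} \<le> card (attachments 1)"
      by (intro card_mono) auto
    then show ?thesis using 0 card_attachments[of 1] by simp
  qed simp
next
  case (step n)
  let ?c = "\<lambda>n d. card {f \<in> attachments n. d < length (heir_path f v n)}"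
  show ?case
  proof (cases d)
    case 0
    have "?c (Suc n) 0 \<le> card (attachments (Suc n))"
      by (intro card_mono) auto
    then show ?thesis using 0 card_attachments[of "Suc n"] by simp
  next
    case (Suc e)
    show ?thesis
    \<comment> \<open>For \<open>d > n\<close> the difference \<open>n - d\<close> would be truncated, but no walk is that long.\<close>
    proof (cases "d \<le> n")
      case False
      then have "{f \<in> attachments (Suc n). d < length (heir_path f v (Suc n))} = {}"
        using length_heir_path_le[of _ "Suc n" v] by fastforce
      then show ?thesis by (simp del: Collect_empty_eq)
    next
      case True
      have upd: "heir_path (g(n := x)) v (Suc n) = graft (heir_path g v n) x (Suc n)" for g x
      proof -
        have "heir_path (g(n := x)) v n = heir_path g v n"
          by (rule heir_path_cong) simp
        then show ?thesis using step.hyps by (simp add: heir_path_Suc)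
      qed
      have "?c (Suc n) d = (\<Sum>g\<in>attachments n.
          card {x \<in> {1..n}. d < length (graft (heir_path g v n) x (Suc n))})"
        using step.hyps by (simp add: card_attachments_Suc upd)
      also have "\<dots> \<le> (\<Sum>g\<in>attachments n. (if d < length (heir_path g v n) then n - d else 0)
          + (if e < length (heir_path g v n) then 1 else 0))"
        unfolding Suc
      proof (intro sum_mono card_graft_longer)
        fix g assume g: "g \<in> attachments n"
        then have ft: "\<And>t. 1 \<le> t \<Longrightarrow> t < n \<Longrightarrow> 1 \<le> g t \<and> g t \<le> t"
          using attachmentsD by blast
        show "distinct (heir_path g v n)"
          "heir_path g v n = [v] \<or> set (heir_path g v n) \<subseteq> {1..n}"
          using heir_path_invariant(3,4)[where f = g, OF ft step.hyps(1)] by auto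
        show "length (heir_path g v n) \<le> n"
          using length_heir_path_le[OF g step.hyps(1)] .
      qed
      also have "\<dots> = (n - d) * ?c n d + ?c n e"
        by (simp add: sum.distrib sum.If_cases Int_def)
      finally have "fact d * ?c (Suc n) d \<le> fact d * ((n - d) * ?c n d + ?c n e)"
        by simp
      also have "\<dots> = (n - d) * (fact d * ?c n d) + d * (fact e * ?c n e)"
        by (simp only: Suc fact_Suc of_nat_id distrib_left mult_ac)
      also have "\<dots> \<le> (n - d) * fact (n - 1) + d * fact (n - 1)"
        using step.IH by (intro add_mono mult_left_mono) auto
      also have "\<dots> = fact n"
        using True step.hyps by (cases n) (simp_all flip: add_mult_distrib)
      finally show ?thesis by simp
    qed
  qed
qed

lemma (in urrt_process) prob_max_leaf_dist_gt:
  assumes "2 \<le> n"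
  shows "prob {\<omega> \<in> space M. d < max_leaf_dist {1..n} (T n \<omega>)} \<le> n / fact (Suc d)"
proof -
  let ?F = "\<lambda>v. {f \<in> attachments n. Suc d < length (heir_path f v n)}"
  have c: "real (card (?F v)) \<le> fact (n - 1) / fact (Suc d)" for v
  proof -
    have "fact (Suc d) * card (?F v) \<le> fact (n - 1)"
      using card_long_heir_path[of n "Suc d" v] assms by simp
    then have "real (fact (Suc d) * card (?F v)) \<le> real (fact (n - 1))"
      by (rule of_nat_mono)
    then show ?thesis by (simp add: field_simps del: fact_Suc)
  qed
  have "{f \<in> attachments n. d < max_leaf_dist {1..n} (rtree n f)} \<subseteq> (\<Union>v\<in>{1..n}. ?F v)"
  proof
    fix f assume f: "f \<in> {f \<in> attachments n. d < max_leaf_dist {1..n} (rtree n f)}"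
    have "\<not> (\<forall>v\<in>{1..n}. length (heir_path f v n) \<le> Suc d)"
    proof
      assume "\<forall>v\<in>{1..n}. length (heir_path f v n) \<le> Suc d"
      then have "max_leaf_dist {1..n} (rtree n f) \<le> d"
        using f by (intro max_leaf_dist_le_heir_path[OF _ assms]) auto
      then show False using f by simp
    qed
    then show "f \<in> (\<Union>v\<in>{1..n}. ?F v)"
      using f by (auto simp: not_le)
  qed
  then have "card {f \<in> attachments n. d < max_leaf_dist {1..n} (rtree n f)}
      \<le> card (\<Union>v\<in>{1..n}. ?F v)"
    by (intro card_mono) auto
  also have "\<dots> \<le> (\<Sum>v\<in>{1..n}. card (?F v))"
    by (rule card_UN_le) simp
  finally have "real (card {f \<in> attachments n. d < max_leaf_dist {1..n} (rtree n f)})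
      \<le> (\<Sum>v\<in>{1..n}. real (card (?F v)))"
    by (simp flip: of_nat_sum)
  also have "\<dots> \<le> (\<Sum>v\<in>{1..n}. fact (n - 1) / fact (Suc d))"
    by (intro sum_mono c)
  finally show ?thesis
    unfolding prob_tree_property(2)[OF assms, of "\<lambda>E. d < max_leaf_dist {1..n} E"]
    by (simp add: field_simps del: fact_Suc)
qed

section \<open>The second moment method for a union of finite sets\<close>

text \<open>
  The Cauchy-Schwarz inequality, applied to the number of sets \<open>A i\<close> that contain a point and the
  indicator function of the union.
\<close>

lemma second_moment_union:
  fixes A :: "'i \<Rightarrow> 'b set"
  assumes "finite I" "\<And>i. i \<in> I \<Longrightarrow> finite (A i)"
  shows "(\<Sum>i\<in>I. real (card (A i)))\<^sup>2
    \<le> real (card (\<Union>i\<in>I. A i)) * (\<Sum>i\<in>I. \<Sum>j\<in>I. real (card (A i \<inter> A j)))"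
proof -
  define U where "U = (\<Union>i\<in>I. A i)"
  have finU: "finite U" unfolding U_def using assms by auto
  have card_ind: "real (card B) = (\<Sum>x\<in>U. indicator B x)" if "B \<subseteq> U" for B
  proof -
    have "(\<Sum>x\<in>U. indicator B x :: real) = real (card (U \<inter> B))"
      using finU by (simp add: indicator_def of_bool_def sum.If_cases)
    then show ?thesis using that by (simp add: Int_absorb1)
  qed
  let ?N = "\<lambda>x. \<Sum>i\<in>I. indicator (A i) x :: real"
  have "(\<Sum>i\<in>I. real (card (A i))) = (\<Sum>i\<in>I. \<Sum>x\<in>U. indicator (A i) x)"
    by (intro sum.cong refl card_ind) (auto simp: U_def)
  also have "\<dots> = (\<Sum>x\<in>U. 1 * ?N x)"
    by (subst sum.swap) simp
  finally have "(\<Sum>i\<in>I. real (card (A i)))\<^sup>2 = (\<Sum>x\<in>U. 1 * ?N x)\<^sup>2"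
    by simp
  also have "\<dots> \<le> (\<Sum>x\<in>U. 1\<^sup>2) * (\<Sum>x\<in>U. (?N x)\<^sup>2)"
    by (rule Cauchy_Schwarz_ineq_sum)
  also have "(\<Sum>x\<in>U. (?N x)\<^sup>2) = (\<Sum>x\<in>U. \<Sum>i\<in>I. \<Sum>j\<in>I. indicator (A i \<inter> A j) x)"
    by (simp add: power2_eq_square sum_product indicator_inter_arith)
  also have "\<dots> = (\<Sum>i\<in>I. \<Sum>j\<in>I. \<Sum>x\<in>U. indicator (A i \<inter> A j) x)"
    by (subst sum.swap) (intro sum.cong refl sum.swap)
  also have "\<dots> = (\<Sum>i\<in>I. \<Sum>j\<in>I. real (card (A i \<inter> A j)))"
    by (intro sum.cong refl card_ind[symmetric]) (auto simp: U_def)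
  finally show ?thesis by (simp add: U_def)
qed

text \<open>
  Here \<open>W\<close> is the total number of points and \<open>\<mu>\<close> a lower bound for the expected number of events
  that occur. Up to the factor \<open>1 / q\<close>, distinct events are no more likely to occur together than
  independent ones; the diagonal terms, which this does not control, contribute the \<open>1 / \<mu>\<close>.
\<close>

lemma second_moment_quasi_independent:
  fixes A :: "'i \<Rightarrow> 'b set" and W q \<mu> :: real
  assumes fin: "finite I" "\<And>i. i \<in> I \<Longrightarrow> finite (A i)"
    and W: "W > 0" and q: "0 < q" "q \<le> 1"
    and \<mu>: "0 < \<mu>" "\<mu> * W \<le> (\<Sum>i\<in>I. real (card (A i)))"
    and pair: "\<And>i j. i \<in> I \<Longrightarrow> j \<in> I \<Longrightarrow> i \<noteq> j \<Longrightarrow>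
      real (card (A i \<inter> A j)) * W * q \<le> real (card (A i)) * real (card (A j))"
  shows "q - 1 / \<mu> \<le> real (card (\<Union>i\<in>I. A i)) / W"
proof -
  define a where "a = (\<lambda>i. real (card (A i)))"
  define S where "S = (\<Sum>i\<in>I. a i)"
  define u where "u = real (card (\<Union>i\<in>I. A i))"
  have S: "S > 0"
    using mult_pos_pos[OF \<mu>(1) W] \<mu>(2) unfolding S_def a_def by linarith
  have a0: "a i \<ge> 0" for i by (simp add: a_def)
  have "(\<Sum>i\<in>I. \<Sum>j\<in>I. real (card (A i \<inter> A j)))
      \<le> (\<Sum>i\<in>I. \<Sum>j\<in>I. (if i = j then a i else 0) + a i * a j / (W * q))"
  proof (intro sum_mono)
    fix i j assume ij: "i \<in> I" "j \<in> I"
    show "real (card (A i \<inter> A j)) \<le> (if i = j then a i else 0) + a i * a j / (W * q)"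
    proof (cases "i = j")
      case True
      have "0 \<le> a i * a j / (W * q)" using W q a0 by simp
      then show ?thesis using True by (simp add: a_def)
    next
      case False
      then show ?thesis using pair[OF ij False] W q by (simp add: a_def field_simps)
    qed
  qed
  also have "\<dots> = S + S * S / (W * q)"
    using fin by (simp add: sum.distrib S_def sum_product sum_divide_distrib sum.delta)
  finally have pairs: "(\<Sum>i\<in>I. \<Sum>j\<in>I. real (card (A i \<inter> A j))) \<le> S + S * S / (W * q)" .
  have "S\<^sup>2 \<le> u * (\<Sum>i\<in>I. \<Sum>j\<in>I. real (card (A i \<inter> A j)))"
    using second_moment_union[OF fin] by (simp add: S_def a_def u_def)
  also have "\<dots> \<le> u * (S + S * S / (W * q))"
    using pairs by (intro mult_left_mono) (auto simp: u_def)
  finally have "S * S \<le> S * (u * (1 + S / (W * q)))"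
    by (simp add: power2_eq_square algebra_simps)
  then have "S \<le> u * (1 + S / (W * q))"
    using S by simp
  then have *: "S * (W * q) \<le> u * (W * q + S)"
    using W q by (simp add: field_simps)
  have "1 / \<mu> \<ge> W / S"
    using \<mu> S W by (simp add: S_def a_def field_simps)
  then have "q - 1 / \<mu> \<le> q - W / S" by simp
  \<comment> \<open>The second moment bound is \<open>S q / (W q + S)\<close>, that is, \<open>q - W q\<^sup>2 / (W q + S)\<close>.\<close>
  also have "\<dots> \<le> q - W * q * q / (W * q + S)"
  proof -
    have "W * q * q * S \<le> W * 1 * 1 * S"
      using W q S by (intro mult_right_mono mult_mono) auto
    also have "\<dots> \<le> W * (W * q + S)" using W q by (simp add: algebra_simps)
    finally have "W * q * q / (W * q + S) \<le> W / S"
      using W q S by (simp add: divide_simps add_pos_pos)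
    then show ?thesis by simp
  qed
  also have "\<dots> = S * (W * q) / (W * q + S) / W"
  proof -
    have "W * q + S \<noteq> 0" using W q S by (metis add_pos_pos less_irrefl mult_pos_pos)
    then have "q = q * (W * q + S) / (W * q + S)" by simp
    then have "q - W * q * q / (W * q + S) = (q * (W * q + S) - W * q * q) / (W * q + S)"
      by (metis diff_divide_distrib)
    also have "q * (W * q + S) - W * q * q = S * q" by (simp add: algebra_simps)
    finally show ?thesis using W by simp
  qed
  also have "\<dots> \<le> u / W"
  proof -
    have "0 < W * q + S" using W q S by (simp add: add_pos_pos)
    then show ?thesis using * W by (intro divide_right_mono) (simp_all add: divide_le_eq)
  qed
  finally show ?thesis by (simp add: u_def)
qed

section \<open>Fringe paths\<close>

text \<open>
  The choices for the parent of vertex \<open>t + 1\<close> that let \<open>a 0, \<dots>, a (k - 1)\<close> become a fringe path: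
  the only vertex that may be attached to \<open>a i\<close> is \<open>a (i + 1)\<close>, and it must be attached there.
  Formulated this way, being a fringe path is a separate condition on each choice, and the number of
  favourable attachment sequences is a product.
\<close>

definition hosts :: "nat \<Rightarrow> (nat \<Rightarrow> nat) \<Rightarrow> nat \<Rightarrow> nat set" where
  "hosts k a t = {x \<in> {1..t}. \<forall>i<k. x = a i \<longleftrightarrow> Suc i < k \<and> Suc t = a (Suc i)}"

definition fringe_path_event :: "nat \<Rightarrow> nat \<Rightarrow> (nat \<Rightarrow> nat) \<Rightarrow> (nat \<Rightarrow> nat) set" where
  "fringe_path_event n k a = (\<Pi>\<^sub>E t\<in>{1..<n}. hosts k a t)"

lemma fringe_path_event_subset: "fringe_path_event n k a \<subseteq> attachments n"
  unfolding fringe_path_event_def attachments_def by (intro PiE_mono) (auto simp: hosts_def)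

lemma fringe_path_eventD:
  assumes "f \<in> fringe_path_event n k a" "1 \<le> t" "t < n" "i < k"
  shows "f t = a i \<longleftrightarrow> Suc i < k \<and> Suc t = a (Suc i)"
proof -
  have "f t \<in> hosts k a t"
    using PiE_mem[OF assms(1)[unfolded fringe_path_event_def], of t] assms(2,3) by simp
  then show ?thesis using assms(4) by (simp add: hosts_def)
qed

lemma hosts_link:
  assumes "strict_mono_on {..<k} a" "1 \<le> a 0" "Suc i < k" "Suc t = a (Suc i)"
  shows "hosts k a t = {a i}"
proof -
  have inj: "j = l" if "a j = a l" "j < k" "l < k" for j l
    using strict_mono_on_imp_inj_on[OF assms(1)] that by (auto dest: inj_onD)
  have "a i < a (Suc i)"
    using assms(3) by (intro strict_mono_onD[OF assms(1)]) auto
  moreover have "a 0 \<le> a i"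
    using assms(3) by (cases i) (auto intro!: less_imp_le[OF strict_mono_onD[OF assms(1)]])
  ultimately have "a i \<in> {1..t}" using assms(2,4) by simp
  moreover have "a i = a j \<longleftrightarrow> Suc j < k \<and> Suc t = a (Suc j)" if "j < k" for j
    using inj[of i j] inj[of "Suc i" "Suc j"] assms(3,4) that by auto
  moreover have "x = a i" if "x \<in> hosts k a t" for x
    using that assms(3,4) unfolding hosts_def by auto
  ultimately show ?thesis unfolding hosts_def by auto
qed

lemma hosts_free:
  assumes "\<And>i. Suc i < k \<Longrightarrow> Suc t \<noteq> a (Suc i)"
  shows "hosts k a t = {1..t} - a ` {..<k}"
  using assms by (auto simp: hosts_def)

text \<open>
  Take \<open>min (i + 1) (k - 1 - i)\<close> as potential of the path vertex \<open>a i\<close>, where \<open>k = 2 * m\<close>, and 0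
  elsewhere. It changes by at most 1 along each edge, because the path is joined to the rest of the
  tree only through \<open>a 0\<close>. It vanishes at the leaves, because the only leaf on the path is its last
  vertex. At the middle vertex \<open>a (m - 1)\<close> it has the value \<open>m\<close>.
\<close>

lemma fringe_path_max_leaf_dist:
  assumes a: "strict_mono_on {..<2 * m} a" "a ` {..<2 * m} \<subseteq> {2..n}"
    and m: "0 < m" and f: "f \<in> fringe_path_event n (2 * m) a"
  shows "m \<le> max_leaf_dist {1..n} (rtree n f)"
proof -
  define k where "k = 2 * m"
  have inj: "inj_on a {..<k}"
    using a(1) strict_mono_on_imp_inj_on unfolding k_def by blast
  have injD: "i = j" if "a i = a j" "i < k" "j < k" for i j
    using inj that by (auto dest: inj_onD)
  have range: "2 \<le> a i" "a i \<le> n" if "i < k" for i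
    using a(2) that unfolding k_def by auto
  have n: "2 \<le> n" using range[of 0] m by (simp add: k_def)
  have f': "f \<in> attachments n" using f fringe_path_event_subset by blast
  note fD = fringe_path_eventD[OF f, folded k_def]
  define g where "g = (\<lambda>x. if x \<in> a ` {..<k}
    then min (Suc (inv_into {..<k} a x)) (k - 1 - inv_into {..<k} a x) else 0)"
  have g_on: "g (a i) = min (Suc i) (k - 1 - i)" if "i < k" for i
    using that inj by (simp add: g_def)
  have g_off: "g x = 0" if "\<And>i. i < k \<Longrightarrow> x \<noteq> a i" for x
    using that by (auto simp: g_def)
  have lip: "g (f t) \<le> Suc (g (Suc t)) \<and> g (Suc t) \<le> Suc (g (f t))"
    if t: "1 \<le> t" "t < n" for t
  proof (cases "\<exists>i<k. Suc t = a i")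
    case True
    then obtain i where i: "i < k" "Suc t = a i" by blast
    show ?thesis
    proof (cases i)
      case 0
      have "f t \<noteq> a j" if "j < k" for j
        using fD[OF t that] i 0 injD[of "Suc j" 0] by auto
      then have "g (f t) = 0" by (rule g_off)
      then show ?thesis using g_on[OF i(1)] i(2) 0 by simp
    next
      case (Suc j)
      then have "f t = a j" using fD[OF t, of j] i by simp
      then show ?thesis using g_on[OF i(1)] g_on[of j] i Suc by auto
    qed
  next
    case False
    then have "f t \<noteq> a j" if "j < k" for j
      using fD[OF t that] by auto
    then show ?thesis using g_off[of "f t"] g_off[of "Suc t"] False by auto
  qed
  have edge: "g x \<le> Suc (g y)" if e: "{x, y} \<in> rtree n f" for x y
  proof -
    obtain t where t: "1 \<le> t" "t < n" "{x, y} = {f t, Suc t}"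
      using e by (auto simp: rtree_def)
    then show ?thesis using lip[of t] by (auto simp: doubleton_eq_iff)
  qed
  have leaf: "g l = 0" if l: "l \<in> leaves {1..n} (rtree n f)" for l
  proof (rule ccontr)
    assume "g l \<noteq> 0"
    then have "\<exists>i<k. l = a i" using g_off[of l] by auto
    then obtain i where i: "i < k" "l = a i" by blast
    then have i1: "Suc i < k" using \<open>g l \<noteq> 0\<close> g_on[of i] by auto
    have lt: "a i < a (Suc i)"
      using i1 strict_mono_onD[OF a(1)] by (simp add: k_def)
    define s where "s = a i - 1"
    define t where "t = a (Suc i) - 1"
    have s: "1 \<le> s" "s < n" "Suc s = l" using range[OF i(1)] i(2) by (auto simp: s_def)
    have t: "1 \<le> t" "t < n" "Suc t = a (Suc i)" using range[OF i1] by (auto simp: t_def)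
    have ft: "f t = l" using fD[OF t(1,2) i(1)] i1 t(3) i(2) by simp
    \<comment> \<open>The edges to the parent and to the next path vertex are distinct.\<close>
    have "{{f s, Suc s}, {f t, Suc t}} \<subseteq> {e \<in> rtree n f. l \<in> e}"
      using rtree_edge[of s n f] rtree_edge[of t n f] s t(1,2) ft by simp
    moreover have "finite {e \<in> rtree n f. l \<in> e}" by (simp add: rtree_def)
    moreover have "{f s, Suc s} \<noteq> {f t, Suc t}"
      using attachmentsD(2)[OF f' s(1,2)] lt s t i by (auto simp: doubleton_eq_iff)
    then have "card {{f s, Suc s}, {f t, Suc t}} = 2" by simp
    ultimately have "2 \<le> degree (rtree n f) l"
      unfolding degree_def by (metis card_mono)
    then show False using l by (simp add: leaves_def)
  qed
  have mid: "m - 1 < k" "g (a (m - 1)) = m" using m g_on[of "m - 1"] by (auto simp: k_def)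
  have "f t \<noteq> n" if "1 \<le> t" "t < n" for t
    using attachmentsD(2)[OF f' that] that by simp
  then have "n \<in> leaves {1..n} (rtree n f)"
    using n by (intro childless_leaf[OF f']) auto
  moreover have "m \<le> graph_dist (rtree n f) (a (m - 1)) l"
    if l: "l \<in> leaves {1..n} (rtree n f)" for l
  proof -
    have "(a (m - 1), l) \<in> (adj (rtree n f))\<^sup>*"
      using l range[OF mid(1)] by (intro rtree_connected[OF f']) (auto simp: leaves_def)
    from potential_le_graph_dist[of "rtree n f" g, OF edge this]
    show ?thesis using leaf[OF l] mid by simp
  qed
  ultimately show ?thesis
    using range[OF mid(1)] by (intro le_max_leaf_dist[of _ "a (m - 1)"]) auto
qed

text \<open>
  Only sequences with one vertex in each of \<open>k\<close> consecutive blocks of length \<open>b\<close> above \<open>s\<close> are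
  considered. They are automatically increasing and easy to count, and a vertex determines its
  position in each sequence that contains it. Only a factor exponential in \<open>k\<close> is lost, compared
  with all increasing sequences.
\<close>

definition ladders :: "nat \<Rightarrow> nat \<Rightarrow> nat \<Rightarrow> (nat \<Rightarrow> nat) set" where
  "ladders s b k = (\<Pi>\<^sub>E i\<in>{..<k}. {s + i * b<..s + Suc i * b})"

lemma finite_ladders: "finite (ladders s b k)"
  by (simp add: ladders_def finite_PiE)

lemma card_ladders: "card (ladders s b k) = b ^ k"
  by (simp add: ladders_def card_PiE)

lemma laddersD:
  assumes "a \<in> ladders s b k" "i < k"
  shows "s + i * b < a i" "a i \<le> s + Suc i * b"
  using assms by (auto simp: ladders_def dest!: PiE_mem[where x = i])

lemma ladder_less:
  assumes "a \<in> ladders s b k" "c \<in> ladders s b k" "i < j" "j < k"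
  shows "a i < c j"
proof -
  have "a i \<le> s + Suc i * b" using laddersD(2)[OF assms(1)] assms by simp
  also have "\<dots> \<le> s + j * b" using assms(3) by (intro add_left_mono mult_right_mono) auto
  also have "\<dots> < c j" using laddersD(1)[OF assms(2)] assms by simp
  finally show ?thesis .
qed

lemma ladder_strict_mono: "a \<in> ladders s b k \<Longrightarrow> strict_mono_on {..<k} a"
  using ladder_less[of a s b k a] by (intro strict_mono_onI) simp

lemma ladder_level_unique:
  assumes "a \<in> ladders s b k" "c \<in> ladders s b k" "i < k" "j < k" "a i = c j"
  shows "i = j"
  using ladder_less[OF assms(1,2), of i j] ladder_less[OF assms(2,1), of j i] assms(3-5)
  by (cases i j rule: linorder_cases) auto

lemma ladder_range:
  assumes "a \<in> ladders s b k" "i < k"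
  shows "s < a i" "a i \<le> s + k * b"
proof -
  have "s + i * b < a i" "a i \<le> s + Suc i * b" using laddersD[OF assms] by auto
  moreover have "Suc i * b \<le> k * b" using assms by (intro mult_right_mono) auto
  ultimately show "s < a i" "a i \<le> s + k * b" by linarith+
qed

text \<open>
  On both events, a common vertex has the same predecessor and the same successor in both sequences,
  namely its parent and its only child. So one common vertex makes the sequences equal.
\<close>

lemma fringe_path_events_disjoint:
  assumes a: "a \<in> ladders s b k" and c: "c \<in> ladders s b k" and ne: "a \<noteq> c"
    and n: "s + k * b \<le> n" and meet: "a i = c i" "i < k"
  shows "fringe_path_event n k a \<inter> fringe_path_event n k c = {}"
proof (rule ccontr)
  assume "fringe_path_event n k a \<inter> fringe_path_event n k c \<noteq> {}"
  then obtain f where f: "f \<in> fringe_path_event n k a" "f \<in> fringe_path_event n k c" by blast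
  have step: "a j = c j \<longleftrightarrow> a (Suc j) = c (Suc j)" if j: "Suc j < k" for j
  proof -
    have chain: "f (d (Suc j) - 1) = d j"
      if d: "d \<in> ladders s b k" "f \<in> fringe_path_event n k d" for d
    proof -
      have "d j < d (Suc j)" "s < d j" "d (Suc j) \<le> n"
        using ladder_less[OF d(1) d(1), of j "Suc j"] ladder_range[OF d(1)] j n
        by (fastforce dest: Suc_lessD)+
      then show ?thesis
        using fringe_path_eventD[OF d(2), of "d (Suc j) - 1" j] j by auto
    qed
    have "c (Suc j) = a (Suc j)" if "a j = c j"
    proof -
      define t where "t = a (Suc j) - 1"
      have t: "1 \<le> t" "t < n" "Suc t = a (Suc j)"
        using ladder_less[OF a a, of j "Suc j"] ladder_range[OF a, of j]
          ladder_range[OF a, of "Suc j"] j n by (auto simp: t_def)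
      have "f t = c j" using chain[OF a f(1)] that by (simp add: t_def)
      then show ?thesis
        using fringe_path_eventD[OF f(2) t(1,2), of j] j t(3) by simp
    qed
    moreover have "a j = c j" if "a (Suc j) = c (Suc j)"
      using chain[OF a f(1)] chain[OF c f(2)] that by simp
    ultimately show ?thesis by auto
  qed
  have to0: "a j = c j \<longleftrightarrow> a 0 = c 0" if "j < k" for j
    using that by (induction j) (use step in auto)
  have "a j = c j" if "j < k" for j
    using to0 meet that by blast
  then have "a = c"
    using a c unfolding ladders_def by (intro PiE_ext) auto
  then show False using ne by simp
qed

section \<open>Existence of a long fringe path\<close>

text \<open>
  Excluding the path vertices that are already born removes at most \<open>k\<close> of \<open>t\<close> choices, and none
  while \<open>t \<le> s\<close>; both are at most the fraction \<open>k / s\<close>.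
\<close>

lemma card_hosts_free_ge:
  assumes a: "a \<in> ladders s b k" and s: "0 < s"
    and free: "\<And>i. Suc i < k \<Longrightarrow> Suc t \<noteq> a (Suc i)"
  shows "(1 - real k / real s) * real t \<le> real (card (hosts k a t))"
proof -
  have h: "hosts k a t = {1..t} - a ` {..<k}" using free by (rule hosts_free)
  show ?thesis
  proof (cases "t \<le> s")
    case True
    then have "hosts k a t = {1..t}"
      using h ladder_range(1)[OF a] by fastforce
    then show ?thesis by (simp add: mult_left_le_one_le algebra_simps)
  next
    case False
    have "card (a ` {..<k}) \<le> k" using card_image_le[of "{..<k}" a] by simp
    then have "t - k \<le> card (hosts k a t)"
      unfolding h using diff_card_le_card_Diff[of "a ` {..<k}" "{1..t}"] by simp
    then have "real t - real k \<le> real (card (hosts k a t))" by linarith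
    moreover have "real k \<le> real k * (real t / real s)"
      using mult_left_mono[of 1 "real t / real s" "real k"] False s by simp
    ultimately show ?thesis by (simp add: algebra_simps)
  qed
qed

lemma card_fringe_path_event:
  "card (fringe_path_event n k a) = (\<Prod>t\<in>{1..<n}. card (hosts k a t))"
  by (simp add: fringe_path_event_def card_PiE)

lemma fact_eq_prod_upto: "(fact (n - 1) :: real) = (\<Prod>t\<in>{1..<n}. real t)"
proof -
  have "{1..<n} = {1..n - 1}" by auto
  then show ?thesis by (simp add: fact_prod)
qed

text \<open>
  Each of the \<open>k - 1\<close> links of the path forces a choice and costs a factor of at least \<open>1 / n\<close>; the
  other choices cost at least \<open>1 - k / s\<close> each. The first path vertex has no forced parent,
  and the factor \<open>n\<close> saved there makes the expected number of fringe paths large.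
\<close>

lemma card_fringe_path_event_ge:
  assumes a: "a \<in> ladders s b k" and s: "k < s" "s + k * b \<le> n"
  shows "(1 / real n) ^ (k - 1) * (1 - real k / real s) ^ n * fact (n - 1)
    \<le> real (card (fringe_path_event n k a))"
proof -
  define r where "r = 1 - real k / real s"
  define P where "P = {t \<in> {1..<n}. Suc t \<in> a ` {1..<k}}"
  define c where "c = (\<lambda>t. if t \<in> P then 1 / real n else r)"
  have r: "0 \<le> r" "r \<le> 1" using s by (auto simp: r_def)
  have n: "1 \<le> n" using s by simp
  have a0: "1 \<le> a 0" if "0 < k" using ladder_range(1)[OF a that] by simp
  have one: "c t * real t \<le> real (card (hosts k a t))" if t: "t \<in> {1..<n}" for t
  proof (cases "\<exists>i. Suc i < k \<and> Suc t = a (Suc i)")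
    case True
    then obtain i where i: "Suc i < k" "Suc t = a (Suc i)" by blast
    then have "t \<in> P" using t unfolding P_def by fastforce
    then have "c t * real t \<le> 1" using t by (simp add: c_def)
    moreover have "hosts k a t = {a i}"
      using i a0 by (intro hosts_link ladder_strict_mono[OF a]) auto
    ultimately show ?thesis by simp
  next
    case False
    have "t \<notin> P"
    proof
      assume "t \<in> P"
      then obtain i where "i \<in> {1..<k}" "Suc t = a i" by (auto simp: P_def)
      then show False using False by (cases i) auto
    qed
    then show ?thesis
      using card_hosts_free_ge[OF a, of t] False t s by (auto simp: c_def r_def)
  qed
  have cardP: "card P \<le> k - 1"
  proof -
    have "card P = card (Suc ` P)" by (simp add: card_image)
    also have "\<dots> \<le> card (a ` {1..<k})" by (intro card_mono) (auto simp: P_def)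
    also have "\<dots> \<le> k - 1" using card_image_le[of "{1..<k}" a] by simp
    finally show ?thesis .
  qed
  have "(1 / real n) ^ (k - 1) * r ^ n \<le> (1 / real n) ^ card P * r ^ card ({1..<n} - P)"
  proof (intro mult_mono power_decreasing)
    have "card ({1..<n} - P) \<le> card {1..<n}" by (intro card_mono) auto
    then show "card ({1..<n} - P) \<le> n" by simp
  qed (use cardP r n in auto)
  also have "\<dots> = (\<Prod>t\<in>{1..<n}. c t)"
  proof -
    have "{1..<n} \<inter> {t. t \<in> P} = P" "{1..<n} \<inter> - {t. t \<in> P} = {1..<n} - P"
      by (auto simp: P_def)
    then show ?thesis by (simp add: c_def prod.If_cases)
  qed
  finally have "(1 / real n) ^ (k - 1) * r ^ n * fact (n - 1)
      \<le> (\<Prod>t\<in>{1..<n}. c t) * (\<Prod>t\<in>{1..<n}. real t)"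
    unfolding fact_eq_prod_upto by (intro mult_right_mono prod_nonneg) auto
  also have "\<dots> \<le> (\<Prod>t\<in>{1..<n}. real (card (hosts k a t)))"
    unfolding prod.distrib[symmetric] using one r by (intro prod_mono) (auto simp: c_def)
  finally show ?thesis by (simp add: card_fringe_path_event r_def)
qed

text \<open>
  The inequality holds for each choice separately. At a time when neither path has a link, the two
  disjoint sets of excluded vertices are negatively correlated:
  \<open>(t - x - y) * t \<le> (t - x) * (t - y)\<close>. At a link of one path, the forced parent avoids the other
  path automatically, and this is what the factor \<open>1 - k / s\<close> compensates. There are at most \<open>2 * k\<close>
  such times.
\<close>

lemma fringe_path_events_quasi_independent:
  assumes a: "a \<in> ladders s b k" and c: "c \<in> ladders s b k"
    and apart: "\<And>i. i < k \<Longrightarrow> a i \<noteq> c i" and s: "k < s"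
  shows "real (card (fringe_path_event n k a \<inter> fringe_path_event n k c)) * fact (n - 1)
      * (1 - real k / real s) ^ (2 * k)
    \<le> real (card (fringe_path_event n k a)) * real (card (fringe_path_event n k c))"
proof -
  define r where "r = 1 - real k / real s"
  define P where "P = {t \<in> {1..<n}. Suc t \<in> a ` {..<k} \<union> c ` {..<k}}"
  define e where "e = (\<lambda>t. if t \<in> P then r else 1)"
  have r: "0 \<le> r" "r \<le> 1" using s by (auto simp: r_def)
  have apart': "a i \<noteq> c j" if "i < k" "j < k" for i j
    using ladder_level_unique[OF a c that] apart[OF that(1)] by auto
  have linked: "real (card (hosts k d t \<inter> hosts k d' t)) * real t * e t
      \<le> real (card (hosts k d t)) * real (card (hosts k d' t))"
    if d: "d \<in> ladders s b k" "d' \<in> ladders s b k" "\<And>i j. i < k \<Longrightarrow> j < k \<Longrightarrow> d i \<noteq> d' j"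
      and i: "Suc i < k" "Suc t = d (Suc i)" and t: "t \<in> {1..<n}" "t \<in> P" for d d' t i
  proof -
    have "1 \<le> d 0" using ladder_range(1)[OF d(1), of 0] i(1) by simp
    then have h: "hosts k d t = {d i}"
      using i by (intro hosts_link ladder_strict_mono[OF d(1)]) auto
    have "card (hosts k d t \<inter> hosts k d' t) \<le> card (hosts k d t)"
      unfolding h by (intro card_mono) auto
    then have "real (card (hosts k d t \<inter> hosts k d' t)) * (real t * e t) \<le> 1 * (real t * e t)"
      using h r by (intro mult_right_mono) (auto simp: e_def)
    also have "\<dots> \<le> real (card (hosts k d' t))"
      using card_hosts_free_ge[OF d(2), of t] s t d(3)[OF i(1)] i(2)
      by (simp add: e_def r_def mult.commute)
    finally show ?thesis using h by (simp add: mult.assoc)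
  qed
  have one: "real (card (hosts k a t \<inter> hosts k c t)) * real t * e t
      \<le> real (card (hosts k a t)) * real (card (hosts k c t))" if t: "t \<in> {1..<n}" for t
  proof -
    consider i where "Suc i < k" "Suc t = a (Suc i)" | i where "Suc i < k" "Suc t = c (Suc i)"
      | "\<And>i. Suc i < k \<Longrightarrow> Suc t \<noteq> a (Suc i)" "\<And>i. Suc i < k \<Longrightarrow> Suc t \<noteq> c (Suc i)"
      by blast
    then show ?thesis
    proof cases
      case (1 i)
      then have "t \<in> P" using t unfolding P_def by auto
      then show ?thesis using linked[OF a c apart' 1 t] by simp
    next
      case (2 i)
      then have "t \<in> P" using t unfolding P_def by auto
      then show ?thesis
        using linked[OF c a _ 2 t] apart' by (metis Int_commute mult.commute)
    next
      case 3
      define x where "x = card ({1..t} \<inter> a ` {..<k})"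
      define y where "y = card ({1..t} \<inter> c ` {..<k})"
      have "({1..t} \<inter> a ` {..<k}) \<inter> ({1..t} \<inter> c ` {..<k}) = {}" using apart' by auto
      then have xy: "card ({1..t} \<inter> (a ` {..<k} \<union> c ` {..<k})) = x + y"
        unfolding x_def y_def Int_Un_distrib by (intro card_Un_disjoint) auto
      have le: "x + y \<le> t"
        unfolding xy[symmetric] using card_mono[of "{1..t}"] by fastforce
      have h: "hosts k a t = {1..t} - a ` {..<k}" "hosts k c t = {1..t} - c ` {..<k}"
        using 3 hosts_free by blast+
      have cards: "card (hosts k a t) = t - x" "card (hosts k c t) = t - y"
        unfolding h x_def y_def by (simp_all add: card_Diff_subset_Int)
      have hh: "hosts k a t \<inter> hosts k c t = {1..t} - (a ` {..<k} \<union> c ` {..<k})"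
        unfolding h by auto
      have "card (hosts k a t \<inter> hosts k c t) = t - (x + y)"
        unfolding hh using xy by (simp add: card_Diff_subset_Int)
      then have "real (card (hosts k a t \<inter> hosts k c t)) * real t * e t
          \<le> (real t - (x + y)) * real t * 1"
        using le r by (intro mult_mono) (auto simp: e_def)
      also have "\<dots> \<le> (real t - x) * (real t - y)" by (simp add: algebra_simps)
      finally show ?thesis using le by (simp add: cards of_nat_diff)
    qed
  qed
  have inter: "fringe_path_event n k a \<inter> fringe_path_event n k c
      = (\<Pi>\<^sub>E t\<in>{1..<n}. hosts k a t \<inter> hosts k c t)"
    by (simp add: fringe_path_event_def PiE_Int)
  have "card P \<le> 2 * k"
  proof -
    have "card P = card (Suc ` P)" by (simp add: card_image)
    also have "\<dots> \<le> card (a ` {..<k} \<union> c ` {..<k})" by (intro card_mono) (auto simp: P_def)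
    also have "\<dots> \<le> card (a ` {..<k}) + card (c ` {..<k})" by (rule card_Un_le)
    also have "\<dots> \<le> 2 * k"
      using card_image_le[of "{..<k}" a] card_image_le[of "{..<k}" c] by simp
    finally show ?thesis .
  qed
  then have "r ^ (2 * k) \<le> r ^ card P" using r by (intro power_decreasing) auto
  also have "\<dots> = (\<Prod>t\<in>{1..<n}. e t)"
  proof -
    have "{1..<n} \<inter> {t. t \<in> P} = P" by (auto simp: P_def)
    then show ?thesis by (simp add: e_def prod.If_cases)
  qed
  finally have "real (card (fringe_path_event n k a \<inter> fringe_path_event n k c)) * fact (n - 1)
      * r ^ (2 * k)
    \<le> real (card (fringe_path_event n k a \<inter> fringe_path_event n k c)) * fact (n - 1)
      * (\<Prod>t\<in>{1..<n}. e t)"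
    by (intro mult_left_mono) auto
  also have "\<dots> = (\<Prod>t\<in>{1..<n}. real (card (hosts k a t \<inter> hosts k c t)) * real t * e t)"
    unfolding inter fact_eq_prod_upto by (simp add: card_PiE prod.distrib)
  also have "\<dots> \<le> (\<Prod>t\<in>{1..<n}. real (card (hosts k a t)) * real (card (hosts k c t)))"
    using one r by (intro prod_mono) (auto simp: e_def)
  finally show ?thesis
    by (simp add: card_fringe_path_event prod.distrib r_def)
qed

text \<open>
  The second moment method for the events that a given one of the \<open>b\<^sup>k\<close> sequences is a fringe path.
  The denominator is the resulting lower bound for the expected number of fringe paths.
\<close>

lemma (in urrt_process) prob_le_max_leaf_dist:
  assumes k: "k = 2 * m" "0 < m" "k < s" and b: "0 < b" "s + k * b \<le> n"
  shows "(1 - real k / real s) ^ (2 * k)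
      - 1 / (real b ^ k * (1 / real n) ^ (k - 1) * (1 - real k / real s) ^ n)
    \<le> prob {\<omega> \<in> space M. m \<le> max_leaf_dist {1..n} (T n \<omega>)}"
proof -
  define r where "r = 1 - real k / real s"
  define A where "A = fringe_path_event n k"
  define I where "I = ladders s b k"
  define \<mu> where "\<mu> = real b ^ k * (1 / real n) ^ (k - 1) * r ^ n"
  have n: "2 \<le> n" using k b by simp
  have r: "0 < r" "r \<le> 1" using k by (auto simp: r_def)
  have "r ^ (2 * k) - 1 / \<mu> \<le> real (card (\<Union>a\<in>I. A a)) / fact (n - 1)"
  proof (rule second_moment_quasi_independent)
    show "finite (A a)" for a
      unfolding A_def by (rule finite_subset[OF fringe_path_event_subset]) simp
    show "0 < \<mu>" using r b n by (simp add: \<mu>_def)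
    have "\<mu> * fact (n - 1) = (\<Sum>a\<in>I. (1 / real n) ^ (k - 1) * r ^ n * fact (n - 1))"
      by (simp add: \<mu>_def I_def card_ladders)
    also have "\<dots> \<le> (\<Sum>a\<in>I. real (card (A a)))"
      unfolding A_def r_def I_def using k b by (intro sum_mono card_fringe_path_event_ge) auto
    finally show "\<mu> * fact (n - 1) \<le> (\<Sum>a\<in>I. real (card (A a)))" .
    show "real (card (A a \<inter> A c)) * fact (n - 1) * r ^ (2 * k)
        \<le> real (card (A a)) * real (card (A c))"
      if ac: "a \<in> I" "c \<in> I" "a \<noteq> c" for a c
    proof (cases "\<exists>i<k. a i = c i")
      case True
      then obtain i where "i < k" "a i = c i" by blast
      then have "A a \<inter> A c = {}"
        using ac b unfolding A_def I_def by (intro fringe_path_events_disjoint) auto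
      then show ?thesis by simp
    next
      case False
      then show ?thesis
        using ac k unfolding A_def I_def r_def
        by (intro fringe_path_events_quasi_independent) auto
    qed
  qed (use r in \<open>auto simp: I_def finite_ladders power_le_one\<close>)
  moreover have "(\<Union>a\<in>I. A a) \<subseteq> {f \<in> attachments n. m \<le> max_leaf_dist {1..n} (rtree n f)}"
  proof
    fix f assume "f \<in> (\<Union>a\<in>I. A a)"
    then obtain a where a: "a \<in> ladders s b k" and f: "f \<in> fringe_path_event n k a"
      by (auto simp: A_def I_def)
    have "a ` {..<k} \<subseteq> {2..n}"
      using ladder_range[OF a] k b by fastforce
    then have "m \<le> max_leaf_dist {1..n} (rtree n f)"
      using ladder_strict_mono[OF a] f k by (intro fringe_path_max_leaf_dist[of m a]) auto
    then show "f \<in> {f \<in> attachments n. m \<le> max_leaf_dist {1..n} (rtree n f)}"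
      using f fringe_path_event_subset by auto
  qed
  then have "real (card (\<Union>a\<in>I. A a)) / fact (n - 1)
      \<le> real (card {f \<in> attachments n. m \<le> max_leaf_dist {1..n} (rtree n f)}) / fact (n - 1)"
    by (intro divide_right_mono of_nat_mono card_mono) auto
  ultimately show ?thesis
    using prob_tree_property(2)[OF n, of "\<lambda>E. m \<le> max_leaf_dist {1..n} E"]
    by (simp add: r_def \<mu>_def)
qed

section \<open>Asymptotics\<close>

lemma fact_ge_power: "(real d / 3) ^ d \<le> fact d"
proof -
  have "real d ^ d / fact d \<le> exp (real d)"
  proof -
    have s: "(\<lambda>i. real d ^ i / fact i) sums exp (real d)"
      using exp_converges[of "real d"] by (simp add: scaleR_conv_of_real divide_inverse mult.commute)
    have "(\<Sum>i\<in>{d}. real d ^ i / fact i) \<le> (\<Sum>i. real d ^ i / fact i)"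
      using sums_summable[OF s] by (intro sum_le_suminf) auto
    then show ?thesis using sums_unique[OF s] by simp
  qed
  also have "\<dots> = exp 1 ^ d" by (simp flip: exp_of_nat_mult)
  also have "\<dots> \<le> 3 ^ d" by (intro power_mono exp_le) simp
  finally show ?thesis by (simp add: power_divide field_simps)
qed

lemma one_minus_power_ge:
  fixes x :: real
  assumes "0 \<le> x" "2 * x \<le> n" "0 < n"
  shows "exp (- 2 * x) \<le> (1 - x / n) ^ n"
proof -
  define y where "y = x / n"
  have y: "0 \<le> y" "y \<le> 1 / 2" using assms by (auto simp: y_def field_simps)
  have "y * y \<le> y * (1 / 2)" using y by (intro mult_left_mono) auto
  then have "- 2 * y \<le> - y - 2 * y\<^sup>2" by (simp add: power2_eq_square)
  also have "\<dots> \<le> ln (1 - y)" using y by (intro ln_one_minus_pos_lower_bound)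
  finally have "real n * (- 2 * y) \<le> real n * ln (1 - y)" by (intro mult_left_mono) auto
  then have "exp (- 2 * x) \<le> exp (real n * ln (1 - y))" using assms(3) by (simp add: y_def)
  also have "\<dots> = (1 - y) ^ n" using y by (simp add: exp_of_nat_mult)
  finally show ?thesis by (simp add: y_def)
qed

text \<open>
  The parameters are \<open>s\<close> about \<open>n / 2\<close> and blocks of length about \<open>n / (2 * k)\<close>, which fill the upper
  half of the vertices. The first summand comes from the correlation of the events, the second
  bounds the reciprocal of the expected number of fringe paths.
\<close>

lemma (in urrt_process) prob_max_leaf_dist_less:
  assumes k: "k = 2 * m" "0 < m" "6 * k \<le> n"
  shows "prob {\<omega> \<in> space M. max_leaf_dist {1..n} (T n \<omega>) < m}
    \<le> (6 * real k ^ 2 + (3 * real k) ^ k * exp (6 * real k)) / n"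
proof -
  define s where "s = n div 2"
  define b where "b = n div (2 * k)"
  define z where "z = 1 - 3 * real k / n"
  define r where "r = 1 - real k / s"
  have k0: "0 < k" "2 \<le> n" using k by auto
  have s: "real n / 3 \<le> s" "k < s" using k k0 by (auto simp: s_def)
  have b: "real n / (3 * k) \<le> b" "s + k * b \<le> n"
  proof -
    have "n < 2 * k * Suc b" unfolding b_def using dividend_less_times_div[of "2 * k" n] k0 by simp
    then have "real n < real (2 * k * Suc b)" by linarith
    then have "real n < 2 * real k * (b + 1)" by (simp add: algebra_simps)
    then have "real n \<le> 3 * real k * b" using k(3) by (simp add: algebra_simps)
    then show "real n / (3 * k) \<le> b" using k0 by (simp add: field_simps)
    have "2 * (k * b) \<le> n" using times_div_less_eq_dividend[of "2 * k" n] by (simp add: b_def mult.assoc)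
    moreover have "2 * s \<le> n" by (simp add: s_def)
    ultimately show "s + k * b \<le> n" by linarith
  qed
  have bpos: "0 < b" using b(1) k0 by (cases b) (auto simp: divide_le_eq)
  have "real k / s \<le> k / (real n / 3)" using s(1) k0 by (intro divide_left_mono) (auto intro!: mult_pos_pos)
  then have zr: "z \<le> r" by (simp add: z_def r_def mult.commute)
  have z: "1 / 2 \<le> z" using k k0 by (simp add: z_def field_simps)
  have q: "1 - 6 * real k ^ 2 / n \<le> r ^ (2 * k)"
  proof -
    have "1 - 6 * real k ^ 2 / n = 1 + real (2 * k) * (z - 1)"
      by (simp add: z_def power2_eq_square)
    also have "\<dots> \<le> (1 + (z - 1)) ^ (2 * k)" using z by (intro Bernoulli_inequality) simp
    also have "\<dots> \<le> r ^ (2 * k)" using z zr by (simp add: power_mono)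
    finally show ?thesis .
  qed
  have \<mu>: "1 / (real b ^ k * (1 / real n) ^ (k - 1) * r ^ n) \<le> (3 * real k) ^ k * exp (6 * real k) / n"
  proof -
    define x where "x = 3 * real k"
    have x: "0 < x" using k0 by (simp add: x_def)
    have e: "real n ^ k * (1 / real n) ^ (k - 1) = n"
      using k0 by (cases k) (simp_all add: power_one_over)
    have "(real n / x) ^ k * (1 / real n) ^ (k - 1) * exp (- 2 * x)
        = (real n ^ k * (1 / real n) ^ (k - 1)) * (exp (- 2 * x) / x ^ k)"
      by (simp add: power_divide)
    also have "\<dots> = n / (x ^ k * exp (2 * x))"
      unfolding e by (simp add: exp_minus divide_inverse)
    finally have "n / ((3 * real k) ^ k * exp (6 * real k))
        = (real n / (3 * k)) ^ k * (1 / real n) ^ (k - 1) * exp (- 2 * (3 * real k))"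
      by (simp add: x_def)
    also have "\<dots> \<le> real b ^ k * (1 / real n) ^ (k - 1) * r ^ n"
    proof (intro mult_mono power_mono b(1))
      have "exp (- 2 * (3 * real k)) \<le> z ^ n"
        unfolding z_def using k k0 by (intro one_minus_power_ge) auto
      also have "\<dots> \<le> r ^ n" using z zr by (intro power_mono) auto
      finally show "exp (- 2 * (3 * real k)) \<le> r ^ n" .
    qed auto
    finally have "n / ((3 * real k) ^ k * exp (6 * real k))
      \<le> real b ^ k * (1 / real n) ^ (k - 1) * r ^ n" .
    then have "1 / (real b ^ k * (1 / real n) ^ (k - 1) * r ^ n)
        \<le> 1 / (n / ((3 * real k) ^ k * exp (6 * real k)))"
      using k0 bpos z zr by (intro divide_left_mono) (auto intro!: mult_pos_pos)
    then show ?thesis by simp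
  qed
  have "prob {\<omega> \<in> space M. max_leaf_dist {1..n} (T n \<omega>) < m}
      = 1 - prob {\<omega> \<in> space M. m \<le> max_leaf_dist {1..n} (T n \<omega>)}"
    using prob_neg[OF prob_tree_property(1)[OF k0(2), of "\<lambda>E. m \<le> max_leaf_dist {1..n} E"]]
    by (simp add: not_le)
  also have "\<dots> \<le> 6 * real k ^ 2 / n + (3 * real k) ^ k * exp (6 * real k) / n"
    using prob_le_max_leaf_dist[OF k(1,2) s(2) bpos b(2)] q \<mu> unfolding r_def by linarith
  finally show ?thesis by (simp add: add_divide_distrib)
qed

definition leaf_dist_scale :: "real \<Rightarrow> real" where
  "leaf_dist_scale x = ln x / ln (ln x)"

text \<open>
  Let \<open>L\<close> be the value of the scale at \<open>n\<close>. With \<open>k\<close> at most \<open>L / 4 + 2\<close>, the failure probability of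
  the lower bound is at most \<open>n\<close> to the power \<open>- 3 / 4 + o(1)\<close>. With \<open>d\<close> at least \<open>3 * L\<close>, the factorial
  of \<open>d\<close> is at least \<open>n\<close> to the power \<open>3 - o(1)\<close>, of which \<open>n\<^sup>2\<close> is enough for the upper bound.
\<close>

lemma leaf_dist_scale_asymptotics:
  shows "eventually (\<lambda>n. 1 \<le> leaf_dist_scale (real n)) at_top"
    and "eventually (\<lambda>n. real n ^ 2 \<le> leaf_dist_scale (real n) powr (3 * leaf_dist_scale (real n))) at_top"
    and "eventually (\<lambda>n. 6 * (leaf_dist_scale (real n) / 4 + 2) \<le> real n) at_top"
    and "(\<lambda>n. (6 * (leaf_dist_scale (real n) / 4 + 2) ^ 2
      + (3 * (leaf_dist_scale (real n) / 4 + 2)) powr (leaf_dist_scale (real n) / 4 + 2)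
      * exp (6 * (leaf_dist_scale (real n) / 4 + 2))) / real n) \<longlonglongrightarrow> 0"
  unfolding leaf_dist_scale_def by real_asymp+

context urrt_process
begin

lemma max_leaf_dist_bigO:
  "bigO_p M (\<lambda>n \<omega>. real (max_leaf_dist {1..n} (T n \<omega>))) (\<lambda>n \<omega>. leaf_dist_scale (real n))"
  unfolding bigO_p_def
proof (intro allI impI)
  fix \<epsilon> :: real assume "\<epsilon> > 0"
  have "(\<lambda>n. 1 / real n) \<longlonglongrightarrow> 0" by real_asymp
  then have "\<forall>\<^sub>F n in at_top. 1 / real n < \<epsilon>" using \<open>\<epsilon> > 0\<close> by (rule order_tendstoD)
  then have "\<forall>\<^sub>F n in at_top. measure M {\<omega> \<in> space M. 3 * leaf_dist_scale (real n)
      < real (max_leaf_dist {1..n} (T n \<omega>))} < \<epsilon>"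
    using leaf_dist_scale_asymptotics(1,2) eventually_ge_at_top[of 2]
  proof eventually_elim
    case (elim n)
    define L where "L = leaf_dist_scale (real n)"
    define d where "d = nat \<lfloor>3 * L\<rfloor>"
    have L: "1 \<le> L" using elim by (simp add: L_def)
    have d: "3 * L \<le> Suc d" "real d \<le> 3 * L" using L by (auto simp: d_def) linarith+
    have "real n ^ 2 \<le> L powr (3 * L)" using elim by (simp add: L_def)
    also have "\<dots> \<le> L powr (Suc d)" using L d by (intro powr_mono) auto
    also have "\<dots> = L ^ Suc d" using L by (intro powr_realpow) simp
    also have "\<dots> \<le> (real (Suc d) / 3) ^ Suc d" using L d by (intro power_mono) auto
    also have "\<dots> \<le> fact (Suc d)" by (rule fact_ge_power)
    finally have big: "real n ^ 2 \<le> fact (Suc d)" .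
    have "prob {\<omega> \<in> space M. 3 * L < real (max_leaf_dist {1..n} (T n \<omega>))}
        \<le> prob {\<omega> \<in> space M. d < max_leaf_dist {1..n} (T n \<omega>)}"
      using d prob_tree_property(1)[OF elim(4), of "\<lambda>E. d < max_leaf_dist {1..n} E"]
      by (intro finite_measure_mono) auto
    also have "\<dots> \<le> n / fact (Suc d)" using elim(4) by (rule prob_max_leaf_dist_gt)
    also have "\<dots> \<le> n / real n ^ 2" using big elim(4) by (intro divide_left_mono) auto
    also have "\<dots> < \<epsilon>" using elim by (simp add: power2_eq_square)
    finally show ?case by (simp add: L_def)
  qed
  then obtain N where "\<forall>n\<ge>N. measure M {\<omega> \<in> space M. 3 * leaf_dist_scale (real n)
      < real (max_leaf_dist {1..n} (T n \<omega>))} < \<epsilon>"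
    by (auto simp: eventually_sequentially)
  then show "\<exists>N>0. \<exists>K>0. \<forall>n\<ge>N. measure M {\<omega> \<in> space M. K * leaf_dist_scale (real n)
      < real (max_leaf_dist {1..n} (T n \<omega>))} < \<epsilon>"
    by (intro exI[of _ "Suc N"] conjI exI[of _ "3 :: real"]) auto
qed

lemma max_leaf_dist_bigOmega:
  "bigOmega_p M (\<lambda>n \<omega>. real (max_leaf_dist {1..n} (T n \<omega>))) (\<lambda>n \<omega>. leaf_dist_scale (real n))"
  unfolding bigOmega_p_def bigO_p_def
proof (intro allI impI)
  fix \<epsilon> :: real assume "\<epsilon> > 0"
  with leaf_dist_scale_asymptotics(4)
  have "\<forall>\<^sub>F n in at_top. (6 * (leaf_dist_scale (real n) / 4 + 2) ^ 2
      + (3 * (leaf_dist_scale (real n) / 4 + 2)) powr (leaf_dist_scale (real n) / 4 + 2)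
      * exp (6 * (leaf_dist_scale (real n) / 4 + 2))) / real n < \<epsilon>"
    by (rule order_tendstoD)
  then have "\<forall>\<^sub>F n in at_top. measure M {\<omega> \<in> space M.
      8 * real (max_leaf_dist {1..n} (T n \<omega>)) < leaf_dist_scale (real n)} < \<epsilon>"
    using leaf_dist_scale_asymptotics(1,3) eventually_ge_at_top[of 2]
  proof eventually_elim
    case (elim n)
    define L where "L = leaf_dist_scale (real n)"
    \<comment> \<open>This makes the path length \<open>k\<close> about \<open>L / 4\<close>, and \<open>m\<close> large enough to exclude \<open>8 * M < L\<close>
      for the maximal leaf distance \<open>M\<close> once \<open>M \<ge> m\<close>.\<close>
    define m where "m = nat \<lceil>L / 8\<rceil>"
    define k where "k = 2 * m"
    define x where "x = L / 4 + 2"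
    have L: "1 \<le> L" using elim by (simp add: L_def)
    have m: "0 < m" "L \<le> 8 * m" "real m \<le> L / 8 + 1"
      using L by (auto simp: m_def) linarith+
    have k: "1 \<le> k" "real k \<le> x" using m by (auto simp: k_def x_def)
    have x: "6 * x \<le> n" using elim by (simp add: x_def L_def)
    have "(3 * real k) ^ k \<le> (3 * x) ^ k" using k by (intro power_mono) auto
    also have "\<dots> = (3 * x) powr k" using k by (intro powr_realpow[symmetric]) simp
    also have "\<dots> \<le> (3 * x) powr x" using k by (intro powr_mono) auto
    finally have pow: "(3 * real k) ^ k \<le> (3 * x) powr x" .
    have "prob {\<omega> \<in> space M. 8 * real (max_leaf_dist {1..n} (T n \<omega>)) < L}
        \<le> prob {\<omega> \<in> space M. max_leaf_dist {1..n} (T n \<omega>) < m}"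
      using m prob_tree_property(1)[OF elim(4), of "\<lambda>E. max_leaf_dist {1..n} E < m"]
      by (intro finite_measure_mono) auto
    also have "\<dots> \<le> (6 * real k ^ 2 + (3 * real k) ^ k * exp (6 * real k)) / n"
      using k x m by (intro prob_max_leaf_dist_less k_def) auto
    also have "\<dots> \<le> (6 * x ^ 2 + (3 * x) powr x * exp (6 * x)) / n"
      using k pow by (intro divide_right_mono add_mono mult_mono power_mono) auto
    also have "\<dots> < \<epsilon>" using elim by (simp add: x_def L_def)
    finally show ?case by (simp add: L_def)
  qed
  then obtain N where "\<forall>n\<ge>N. measure M {\<omega> \<in> space M.
      8 * real (max_leaf_dist {1..n} (T n \<omega>)) < leaf_dist_scale (real n)} < \<epsilon>"
    by (auto simp: eventually_sequentially)
  then show "\<exists>N>0. \<exists>K>0. \<forall>n\<ge>N. measure M {\<omega> \<in> space M.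
      K * real (max_leaf_dist {1..n} (T n \<omega>)) < leaf_dist_scale (real n)} < \<epsilon>"
    by (intro exI[of _ "Suc N"] conjI exI[of _ "8 :: real"]) auto
qed

end

theorem theorem4p4:
  fixes M :: "'w measure"
    and T :: "nat \<Rightarrow> 'w \<Rightarrow> nat set set"
    and parent :: "nat \<Rightarrow> 'w \<Rightarrow> nat"
  assumes "urrt_process M T parent"
  shows "bigTheta_p M
    (\<lambda>n \<omega>. real (max_leaf_dist {1..n} (T n \<omega>)))
    (\<lambda>n \<omega>. ln (real n) / ln (ln (real n)))"
  using urrt_process.max_leaf_dist_bigO[OF assms] urrt_process.max_leaf_dist_bigOmega[OF assms]
  by (simp add: bigTheta_p_def leaf_dist_scale_def)

end
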